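(* Let $\mathfrak A$ be a generalized model (in the narrow sense) with universe $\beta X$. Then for every first-order formula $\varphi(x_1,\dots,x_n)$ and all $\mathfrak u_1,\dots,\mathfrak u_n\in\beta X$: $\mathfrak A\Vdash\varphi[\mathfrak u_1,\dots,\mathfrak u_n]$ if and only if $e(\mathfrak A)\models\varphi[\mathfrak u_1,\dots,\mathfrak u_n]$.
   Context: For a set $Z$, $\beta Z$ is the set of ultrafilters on $Z$, with $Z\subseteq\beta Z$ via principal ultrafilters and the standard compact Hausdorff topology with base $\{\mathfrak u:A\in\mathfrak u\}$. $(\forall^{\mathfrak u}z)\varphi(z)$ means $\{z:\varphi(z)\}\in\mathfrak u$. Fix a first-order signature and a set $X$. A generalized model in the narrow sense $\mathfrak A$ with universe $\beta X$ is given by an interpretation $\imath$ assigning to each $n$-ary functional symbol $F$ an ultrafilter $\imath(F)\in\beta(X^{X^n})$ and to each $n$-ary predicate symbol $R$ an ultrafilter $\imath(R)\in\beta\,\mathcal P(X^n)$. Define $\widetilde{\mathrm{app}}(\mathfrak u_1,\dots,\mathfrak u_n,\mathfrak f)=\{A\subseteq X:(\forall^{\mathfrak u_1}x_1)\cdots(\forall^{\mathfrak u_n}x_n)(\forall^{\mathfrak f}f)\,f(x_1,\dots,x_n)\in A\}$ and $\widetilde{\mathrm{in}}(\mathfrak u_1,\dots,\mathfrak u_n,\mathfrak r)$ iff $(\forall^{\mathfrak u_1}x_1)\cdots(\forall^{\mathfrak u_n}x_n)(\forall^{\mathfrak r}Q)\,(x_1,\dots,x_n)\in Q$. For a valuation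 $v$ of variables in $\beta X$, extend to terms by $v_\imath(x)=v(x)$, $v_\imath(F(t_1,\dots,t_n))=\widetilde{\mathrm{app}}(v_\imath(t_1),\dots,v_\imath(t_n),\imath(F))$. Satisfaction: $\mathfrak A\Vdash t_1=t_2[v]$ iff $v_\imath(t_1)=v_\imath(t_2)$; $\mathfrak A\Vdash R(t_1,\dots,t_n)[v]$ iff $\widetilde{\mathrm{in}}(v_\imath(t_1),\dots,v_\imath(t_n),\imath(R))$; negation, conjunction and quantifiers (ranging over $\beta X$) as usual. The ordinary model $e(\mathfrak A)=(\beta X,e(\imath(F)),\dots,e(\imath(R)),\dots)$ is defined as follows. Let $\mathrm{RC}_n$ be the set of maps $g:(\beta X)^n\to\beta X$ right continuous w.r.t. $X$ (for each $i$, all $a_1,\dots,a_{i-1}\in X$ and $\mathfrak u_{i+1},\dots,\mathfrak u_n\in\beta X$, $\mathfrak u\mapsto g(a_1,\dots,a_{i-1},\mathfrak u,\mathfrak u_{i+1},\dots,\mathfrak u_n)$ is continuous), with the topology with subbase $\{g:g(a)\in U\}$, $a\in X^n$, $U\subseteq\beta X$ open (a compact Hausdorff space). For $f:X^n\to X$, $\tilde f(\mathfrak u_1,\dots,\mathfrak u_n)=\{A:(\forall^{\mathfrak u_1}x_1)\cdots(\forall^{\mathfrak u_n}x_n)f(x_1,\dots,x_n)\in A\}\in\mathrm{RC}_n$, and $e:\beta(X^{X^n})\to\mathrm{RC}_n$ is the unique continuous extension of $f\mapsto\tilde f$ ($X^{X^n}$ discrete). For relations, identify $Q\subseteq X^n$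 with its characteristic function into the discrete space $\{0,1\}$ and define $e:\beta\,\mathcal P(X^n)\to\mathcal P((\beta X)^n)$ by the same construction (the extension of $Q$ being $\tilde Q=\{(\mathfrak u_1,\dots,\mathfrak u_n):(\forall^{\mathfrak u_1}x_1)\cdots(\forall^{\mathfrak u_n}x_n)(x_1,\dots,x_n)\in Q\}$). *)

theory Defs
  imports "HOL-Analysis.Analysis" "HOL-Library.NList"
begin

section \<open>Ultrafilters on a set\<close>

text \<open>
  Ultrafilters on a set \<open>Z\<close> are rendered by library filters concentrated on \<open>Z\<close>:
  \<open>A \<in> \<uu>\<close> is \<open>\<forall>\<^sub>F z in \<uu>. z \<in> A\<close>, the quantifier \<open>(\<forall>\<^sup>\<uu> z) \<phi> z\<close> is
  \<open>\<forall>\<^sub>F z in \<uu>. \<phi> z\<close>, and the principal ultrafilter of \<open>z\<close> is \<open>principal {z}\<close>.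
  No nonemptiness of \<open>Z\<close> is required; \<open>ultrafilters {} = {}\<close>.
\<close>

definition ultrafilters :: "'z set \<Rightarrow> 'z filter set" where
  "ultrafilters Z = {\<uu>. (\<forall>\<^sub>F z in \<uu>. z \<in> Z) \<and> \<uu> \<noteq> bot \<and>
     (\<forall>A\<subseteq>Z. (\<forall>\<^sub>F z in \<uu>. z \<in> A) \<or> (\<forall>\<^sub>F z in \<uu>. z \<in> Z - A))}"

definition beta_topology :: "'z set \<Rightarrow> 'z filter topology" where
  "beta_topology Z = topology_generated_by
     {{\<uu> \<in> ultrafilters Z. \<forall>\<^sub>F z in \<uu>. z \<in> A} | A. A \<subseteq> Z}"

abbreviation principal_tuple :: "'a list \<Rightarrow> 'a filter list" where
  "principal_tuple \<equiv> map (\<lambda>a. principal {a})"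

text \<open>\<open>X\<^sup>n\<close> is \<open>nlists n X\<close>; \<open>iter_ev [\<uu>\<^sub>1, \<dots>, \<uu>\<^sub>n] \<phi>\<close> is
  \<open>(\<forall>\<^sup>\<uu>\<^sup>1 x\<^sub>1) \<dots> (\<forall>\<^sup>\<uu>\<^sup>n x\<^sub>n) \<phi> [x\<^sub>1, \<dots>, x\<^sub>n]\<close>.\<close>

primrec iter_ev :: "'a filter list \<Rightarrow> ('a list \<Rightarrow> bool) \<Rightarrow> bool" where
  "iter_ev [] \<phi> \<longleftrightarrow> \<phi> []"
| "iter_ev (\<uu> # us) \<phi> \<longleftrightarrow> (\<forall>\<^sub>F x in \<uu>. iter_ev us (\<lambda>xs. \<phi> (x # xs)))"

lemma iter_ev_mono: "iter_ev us \<phi> \<Longrightarrow> (\<And>xs. \<phi> xs \<Longrightarrow> \<psi> xs) \<Longrightarrow> iter_ev us \<psi>"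
proof (induction us arbitrary: \<phi> \<psi>)
  case (Cons u us)
  from Cons.prems(1) have "\<forall>\<^sub>F x in u. iter_ev us (\<lambda>xs. \<phi> (x # xs))" by simp
  then have "\<forall>\<^sub>F x in u. iter_ev us (\<lambda>xs. \<psi> (x # xs))"
    by (rule eventually_mono) (erule Cons.IH, rule Cons.prems(2))
  then show ?case by simp
qed simp

lemma iter_ev_True: "iter_ev us (\<lambda>_. True)"
  by (induction us) simp_all

lemma iter_ev_conj: "iter_ev us (\<lambda>xs. \<phi> xs \<and> \<psi> xs) \<longleftrightarrow> iter_ev us \<phi> \<and> iter_ev us \<psi>"
  by (induction us arbitrary: \<phi> \<psi>) (simp_all add: eventually_conj_iff)

section \<open>Generalized application and membership\<close>

definition app_tilde :: "'a filter list \<Rightarrow> ('a list \<Rightarrow> 'a) filter \<Rightarrow> 'a filter" where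
  "app_tilde us \<ff> = Abs_filter (\<lambda>P. iter_ev us (\<lambda>xs. \<forall>\<^sub>F f in \<ff>. P (f xs)))"

definition in_tilde :: "'a filter list \<Rightarrow> 'a list set filter \<Rightarrow> bool" where
  "in_tilde us \<rr> \<longleftrightarrow> iter_ev us (\<lambda>xs. \<forall>\<^sub>F Q in \<rr>. xs \<in> Q)"

lemma eventually_app_tilde:
  "eventually P (app_tilde us \<ff>) \<longleftrightarrow> iter_ev us (\<lambda>xs. \<forall>\<^sub>F f in \<ff>. P (f xs))"
proof -
  have "is_filter (\<lambda>P. iter_ev us (\<lambda>xs. \<forall>\<^sub>F f in \<ff>. P (f xs)))"
  proof
    fix P Q :: "'a \<Rightarrow> bool"
    assume "\<forall>y. P y \<longrightarrow> Q y" and "iter_ev us (\<lambda>xs. \<forall>\<^sub>F f in \<ff>. P (f xs))"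
    then show "iter_ev us (\<lambda>xs. \<forall>\<^sub>F f in \<ff>. Q (f xs))"
      by (elim iter_ev_mono eventually_mono) simp
  qed (simp_all add: iter_ev_True iter_ev_conj eventually_conj_iff)
  then show ?thesis unfolding app_tilde_def by (rule eventually_Abs_filter)
qed

section \<open>Right continuous maps and the extension map \<open>e\<close>\<close>

text \<open>
  The codomain \<open>T\<close> is \<open>beta_topology X\<close> for operations and the two-point discrete space for
  relations. Maps are extensional, so that equality in \<open>RC\<close> is equality of maps on \<open>(\<beta>X)\<^sup>n\<close>.
\<close>

definition RC :: "'a set \<Rightarrow> nat \<Rightarrow> 'b topology \<Rightarrow> ('a filter list \<Rightarrow> 'b) set" where
  "RC X n T = {g \<in> nlists n (ultrafilters X) \<rightarrow>\<^sub>E topspace T.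
     \<forall>as us. set as \<subseteq> X \<and> set us \<subseteq> ultrafilters X \<and> length as + 1 + length us = n \<longrightarrow>
       continuous_map (beta_topology X) T (\<lambda>\<uu>. g (principal_tuple as @ \<uu> # us))}"

text \<open>\<open>RC X n T\<close> itself is listed among the generators because
  \<open>topology_generated_by\<close> does not add the empty intersection; this matters only if \<open>X\<^sup>n\<close> is empty.\<close>

definition RC_topology :: "'a set \<Rightarrow> nat \<Rightarrow> 'b topology \<Rightarrow> ('a filter list \<Rightarrow> 'b) topology" where
  "RC_topology X n T = topology_generated_by (insert (RC X n T)
     {{g \<in> RC X n T. g (principal_tuple a) \<in> U} | a U. a \<in> nlists n X \<and> openin T U})"

text \<open>The unique continuous extension to \<open>\<beta>Z\<close> of a map \<open>j\<close> from the discrete space \<open>Z\<close> to \<open>Y\<close>.\<close>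

definition continuous_ext :: "'z set \<Rightarrow> 'y topology \<Rightarrow> ('z \<Rightarrow> 'y) \<Rightarrow> 'z filter \<Rightarrow> 'y" where
  "continuous_ext Z Y j = (THE h. h \<in> extensional (ultrafilters Z) \<and>
     continuous_map (beta_topology Z) Y h \<and> (\<forall>z\<in>Z. h (principal {z}) = j z))"

definition fun_ext :: "'a set \<Rightarrow> nat \<Rightarrow> ('a list \<Rightarrow> 'a) \<Rightarrow> 'a filter list \<Rightarrow> 'a filter" where
  "fun_ext X n f = (\<lambda>us\<in>nlists n (ultrafilters X). Abs_filter (\<lambda>P. iter_ev us (\<lambda>xs. P (f xs))))"

lemma eventually_fun_ext:
  assumes "us \<in> nlists n (ultrafilters X)"
  shows "eventually P (fun_ext X n f us) \<longleftrightarrow> iter_ev us (\<lambda>xs. P (f xs))"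
proof -
  have "is_filter (\<lambda>P. iter_ev us (\<lambda>xs. P (f xs)))"
  proof
    fix P Q :: "'a \<Rightarrow> bool"
    assume "\<forall>y. P y \<longrightarrow> Q y" and "iter_ev us (\<lambda>xs. P (f xs))"
    then show "iter_ev us (\<lambda>xs. Q (f xs))"
      by (elim iter_ev_mono) simp
  qed (simp_all add: iter_ev_True iter_ev_conj)
  then show ?thesis using assms unfolding fun_ext_def by (simp add: eventually_Abs_filter)
qed

definition rel_ext :: "'a set \<Rightarrow> nat \<Rightarrow> 'a list set \<Rightarrow> 'a filter list set" where
  "rel_ext X n Q = {us \<in> nlists n (ultrafilters X). iter_ev us (\<lambda>xs. xs \<in> Q)}"

definition e_fun :: "'a set \<Rightarrow> nat \<Rightarrow> ('a list \<Rightarrow> 'a) filter \<Rightarrow> 'a filter list \<Rightarrow> 'a filter" where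
  "e_fun X n = continuous_ext (nlists n X \<rightarrow>\<^sub>E X) (RC_topology X n (beta_topology X)) (fun_ext X n)"

text \<open>Characteristic functions take values in \<open>bool\<close>, with \<open>True\<close> playing the role of \<open>1\<close>.\<close>

definition e_char :: "'a set \<Rightarrow> nat \<Rightarrow> 'a list set filter \<Rightarrow> 'a filter list \<Rightarrow> bool" where
  "e_char X n = continuous_ext (Pow (nlists n X)) (RC_topology X n (discrete_topology UNIV))
     (\<lambda>Q. \<lambda>us\<in>nlists n (ultrafilters X). us \<in> rel_ext X n Q)"

definition e_rel :: "'a set \<Rightarrow> nat \<Rightarrow> 'a list set filter \<Rightarrow> 'a filter list set" where
  "e_rel X n \<rr> = {us \<in> nlists n (ultrafilters X). e_char X n \<rr> us}"

section \<open>First-order syntax\<close>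

record ('f, 'p) signature =
  fun_syms :: "'f set"
  pred_syms :: "'p set"
  fun_arity :: "'f \<Rightarrow> nat"
  pred_arity :: "'p \<Rightarrow> nat"

datatype 'f tm = Var nat | Fun 'f "'f tm list"

datatype ('f, 'p) fm =
    Eq "'f tm" "'f tm"
  | Rel 'p "'f tm list"
  | Neg "('f, 'p) fm"
  | Conj "('f, 'p) fm" "('f, 'p) fm"
  | Forall nat "('f, 'p) fm"
  | Exists nat "('f, 'p) fm"

primrec wf_tm :: "('f, 'p) signature \<Rightarrow> 'f tm \<Rightarrow> bool" where
  "wf_tm S (Var x) \<longleftrightarrow> True"
| "wf_tm S (Fun F ts) \<longleftrightarrow>
     F \<in> fun_syms S \<and> length ts = fun_arity S F \<and> list_all (wf_tm S) ts"

primrec wf_fm :: "('f, 'p) signature \<Rightarrow> ('f, 'p) fm \<Rightarrow> bool" where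
  "wf_fm S (Eq s t) \<longleftrightarrow> wf_tm S s \<and> wf_tm S t"
| "wf_fm S (Rel R ts) \<longleftrightarrow>
     R \<in> pred_syms S \<and> length ts = pred_arity S R \<and> list_all (wf_tm S) ts"
| "wf_fm S (Neg \<phi>) \<longleftrightarrow> wf_fm S \<phi>"
| "wf_fm S (Conj \<phi> \<psi>) \<longleftrightarrow> wf_fm S \<phi> \<and> wf_fm S \<psi>"
| "wf_fm S (Forall x \<phi>) \<longleftrightarrow> wf_fm S \<phi>"
| "wf_fm S (Exists x \<phi>) \<longleftrightarrow> wf_fm S \<phi>"

primrec vars_tm :: "'f tm \<Rightarrow> nat set" where
  "vars_tm (Var x) = {x}"
| "vars_tm (Fun F ts) = \<Union> (set (map vars_tm ts))"

primrec free_vars :: "('f, 'p) fm \<Rightarrow> nat set" where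
  "free_vars (Eq s t) = vars_tm s \<union> vars_tm t"
| "free_vars (Rel R ts) = \<Union> (set (map vars_tm ts))"
| "free_vars (Neg \<phi>) = free_vars \<phi>"
| "free_vars (Conj \<phi> \<psi>) = free_vars \<phi> \<union> free_vars \<psi>"
| "free_vars (Forall x \<phi>) = free_vars \<phi> - {x}"
| "free_vars (Exists x \<phi>) = free_vars \<phi> - {x}"

section \<open>Ordinary models\<close>

record ('d, 'f, 'p) model =
  univ :: "'d set"
  fun_int :: "'f \<Rightarrow> 'd list \<Rightarrow> 'd"
  pred_int :: "'p \<Rightarrow> 'd list set"

primrec val :: "('d, 'f, 'p) model \<Rightarrow> (nat \<Rightarrow> 'd) \<Rightarrow> 'f tm \<Rightarrow> 'd" where
  "val M v (Var x) = v x"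
| "val M v (Fun F ts) = fun_int M F (map (val M v) ts)"

primrec sat :: "('d, 'f, 'p) model \<Rightarrow> ('f, 'p) fm \<Rightarrow> (nat \<Rightarrow> 'd) \<Rightarrow> bool" where
  "sat M (Eq s t) v \<longleftrightarrow> val M v s = val M v t"
| "sat M (Rel R ts) v \<longleftrightarrow> map (val M v) ts \<in> pred_int M R"
| "sat M (Neg \<phi>) v \<longleftrightarrow> \<not> sat M \<phi> v"
| "sat M (Conj \<phi> \<psi>) v \<longleftrightarrow> sat M \<phi> v \<and> sat M \<psi> v"
| "sat M (Forall x \<phi>) v \<longleftrightarrow> (\<forall>d\<in>univ M. sat M \<phi> (v(x := d)))"
| "sat M (Exists x \<phi>) v \<longleftrightarrow> (\<exists>d\<in>univ M. sat M \<phi> (v(x := d)))"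

section \<open>Generalized models in the narrow sense\<close>

text \<open>The universe of the generalized model is \<open>ultrafilters (base A)\<close>.\<close>

record ('a, 'f, 'p) gen_model =
  base :: "'a set"
  gfun_int :: "'f \<Rightarrow> ('a list \<Rightarrow> 'a) filter"
  gpred_int :: "'p \<Rightarrow> 'a list set filter"

definition is_gen_model :: "('f, 'p) signature \<Rightarrow> ('a, 'f, 'p) gen_model \<Rightarrow> bool" where
  "is_gen_model S A \<longleftrightarrow>
     (\<forall>F\<in>fun_syms S. gfun_int A F \<in> ultrafilters (nlists (fun_arity S F) (base A) \<rightarrow>\<^sub>E base A)) \<and>
     (\<forall>R\<in>pred_syms S. gpred_int A R \<in> ultrafilters (Pow (nlists (pred_arity S R) (base A))))"

primrec gval :: "('a, 'f, 'p) gen_model \<Rightarrow> (nat \<Rightarrow> 'a filter) \<Rightarrow> 'f tm \<Rightarrow> 'a filter" where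
  "gval A v (Var x) = v x"
| "gval A v (Fun F ts) = app_tilde (map (gval A v) ts) (gfun_int A F)"

primrec gsat :: "('a, 'f, 'p) gen_model \<Rightarrow> ('f, 'p) fm \<Rightarrow> (nat \<Rightarrow> 'a filter) \<Rightarrow> bool" where
  "gsat A (Eq s t) v \<longleftrightarrow> gval A v s = gval A v t"
| "gsat A (Rel R ts) v \<longleftrightarrow> in_tilde (map (gval A v) ts) (gpred_int A R)"
| "gsat A (Neg \<phi>) v \<longleftrightarrow> \<not> gsat A \<phi> v"
| "gsat A (Conj \<phi> \<psi>) v \<longleftrightarrow> gsat A \<phi> v \<and> gsat A \<psi> v"
| "gsat A (Forall x \<phi>) v \<longleftrightarrow> (\<forall>\<uu>\<in>ultrafilters (base A). gsat A \<phi> (v(x := \<uu>)))"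
| "gsat A (Exists x \<phi>) v \<longleftrightarrow> (\<exists>\<uu>\<in>ultrafilters (base A). gsat A \<phi> (v(x := \<uu>)))"

definition e_model ::
    "('f, 'p) signature \<Rightarrow> ('a, 'f, 'p) gen_model \<Rightarrow> ('a filter, 'f, 'p) model" where
  "e_model S A = \<lparr>univ = ultrafilters (base A),
     fun_int = (\<lambda>F. e_fun (base A) (fun_arity S F) (gfun_int A F)),
     pred_int = (\<lambda>R. e_rel (base A) (pred_arity S R) (gpred_int A R))\<rparr>"

end

theory Submission
  imports Defs
begin

text \<open>
  Both \<open>\<ff> \<mapsto> app_tilde \<cdot> \<ff>\<close> and \<open>e\<close> are continuous extensions of \<open>f \<mapsto> fun_ext f\<close> to the space of
  ultrafilters. Such an extension into \<open>RC\<close> is unique: principal ultrafilters are dense, and an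
  element of \<open>RC\<close> is determined by its values on principal tuples, as one sees by freeing the
  arguments from right to left with right continuity. Hence \<open>e\<close> interprets every symbol
  exactly as \<open>app_tilde\<close> and \<open>in_tilde\<close> do, and the two satisfaction relations agree.
\<close>

section \<open>The space of ultrafilters\<close>

lemma ultrafilters_not_bot: "\<uu> \<in> ultrafilters Z \<Longrightarrow> \<uu> \<noteq> bot"
  by (simp add: ultrafilters_def)

lemma ultrafilters_eventually_carrier: "\<uu> \<in> ultrafilters Z \<Longrightarrow> \<forall>\<^sub>F z in \<uu>. z \<in> Z"
  by (simp add: ultrafilters_def)

lemma ultrafilters_subset_cases:
  "\<uu> \<in> ultrafilters Z \<Longrightarrow> A \<subseteq> Z \<Longrightarrow> (\<forall>\<^sub>F z in \<uu>. z \<in> A) \<or> (\<forall>\<^sub>F z in \<uu>. z \<in> Z - A)"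
  by (simp add: ultrafilters_def)

text \<open>An ultrafilter quantifier is self-dual. This is what separates points of
  \<open>beta_topology\<close> and lets negation pass through every quantifier in
  \<open>app_tilde\<close> and \<open>in_tilde\<close>.\<close>

lemma ultrafilters_eventually_not:
  assumes "\<uu> \<in> ultrafilters Z"
  shows "(\<forall>\<^sub>F z in \<uu>. \<not> P z) \<longleftrightarrow> \<not> (\<forall>\<^sub>F z in \<uu>. P z)"
proof
  assume "\<forall>\<^sub>F z in \<uu>. \<not> P z"
  then show "\<not> (\<forall>\<^sub>F z in \<uu>. P z)"
    using ultrafilters_not_bot[OF assms] eventually_conj[of P \<uu> "\<lambda>z. \<not> P z"] by auto
next
  assume "\<not> (\<forall>\<^sub>F z in \<uu>. P z)"
  \<comment> \<open>The definition decides only subsets of \<open>Z\<close>, so \<open>P\<close> is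
    first cut down to \<open>Z\<close>.\<close>
  then have "\<not> (\<forall>\<^sub>F z in \<uu>. z \<in> {z \<in> Z. P z})"
    by (auto simp: eventually_conj_iff)
  moreover have "(\<forall>\<^sub>F z in \<uu>. z \<in> {z \<in> Z. P z}) \<or> (\<forall>\<^sub>F z in \<uu>. z \<in> Z - {z \<in> Z. P z})"
    by (rule ultrafilters_subset_cases[OF assms]) simp
  ultimately have "\<forall>\<^sub>F z in \<uu>. z \<in> Z - {z \<in> Z. P z}"
    by argo
  then show "\<forall>\<^sub>F z in \<uu>. \<not> P z"
    by (rule eventually_mono) simp
qed

text \<open>Self-duality at the constant predicate \<open>True\<close> excludes \<open>bot\<close>,
  and at membership in a set it decides that set. A filter given by quantifiers is thus an
  ultrafilter as soon as negation can be pushed inward.\<close>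

lemma ultrafiltersI:
  assumes "\<forall>\<^sub>F z in \<uu>. z \<in> Z"
    and "\<And>P. (\<forall>\<^sub>F z in \<uu>. \<not> P z) \<longleftrightarrow> \<not> (\<forall>\<^sub>F z in \<uu>. P z)"
  shows "\<uu> \<in> ultrafilters Z"
proof -
  have "\<uu> \<noteq> bot"
    using assms(2)[of "\<lambda>_. True"] by auto
  moreover have "(\<forall>\<^sub>F z in \<uu>. z \<in> B) \<or> (\<forall>\<^sub>F z in \<uu>. z \<in> Z - B)" for B
    using assms(1) assms(2)[of "\<lambda>z. z \<in> B"] by (auto simp: eventually_conj_iff)
  ultimately show ?thesis
    using assms(1) by (simp add: ultrafilters_def)
qed

lemma principal_in_ultrafilters: "z \<in> Z \<Longrightarrow> principal {z} \<in> ultrafilters Z"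
  by (rule ultrafiltersI) (simp_all add: eventually_principal)

lemma topspace_beta_topology: "topspace (beta_topology Z) = ultrafilters Z"
  unfolding beta_topology_def topology_generated_by_topspace
  using ultrafilters_eventually_carrier by blast

text \<open>Ultrafilters on \<open>Z\<close> are concentrated on \<open>Z\<close>, so
  \<open>P\<close> and its trace on \<open>Z\<close> define the same set, and the trace gives a
  generator.\<close>

lemma openin_beta_basic: "openin (beta_topology Z) {\<uu> \<in> ultrafilters Z. \<forall>\<^sub>F z in \<uu>. P z}"
proof -
  have "(\<forall>\<^sub>F z in \<uu>. P z) \<longleftrightarrow> (\<forall>\<^sub>F z in \<uu>. z \<in> {z \<in> Z. P z})" if "\<uu> \<in> ultrafilters Z" for \<uu>
    using ultrafilters_eventually_carrier[OF that] by (simp add: eventually_conj_iff)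
  then have "{\<uu> \<in> ultrafilters Z. \<forall>\<^sub>F z in \<uu>. P z} =
      {\<uu> \<in> ultrafilters Z. \<forall>\<^sub>F z in \<uu>. z \<in> {z \<in> Z. P z}}"
    by (simp cong: conj_cong)
  then show ?thesis
    unfolding beta_topology_def
    by (intro topology_generated_by_Basis CollectI exI[of _ "{z \<in> Z. P z}"]) simp
qed

text \<open>The generators of \<open>beta_topology\<close>, named because their closure under
  intersection makes them a base and not merely a subbase.\<close>

definition beta_basic :: "'z set \<Rightarrow> 'z set \<Rightarrow> 'z filter set" where
  "beta_basic Z A = {\<uu> \<in> ultrafilters Z. \<forall>\<^sub>F z in \<uu>. z \<in> A}"

lemma beta_basic_Int: "beta_basic Z (A \<inter> B) = beta_basic Z A \<inter> beta_basic Z B"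
  by (auto simp: beta_basic_def eventually_conj_iff)

text \<open>Induction on the generation of \<open>U\<close>: intersections are handled by
  \<open>beta_basic_Int\<close>, and a union inherits the neighbourhood from one of its
  members.\<close>

lemma openin_beta_basic_nbhd:
  assumes "openin (beta_topology Z) U" and "\<uu> \<in> U"
  obtains A where "A \<subseteq> Z" "\<uu> \<in> beta_basic Z A" "beta_basic Z A \<subseteq> U"
proof -
  have "generate_topology_on {beta_basic Z A | A. A \<subseteq> Z} U"
    using assms(1) unfolding beta_topology_def beta_basic_def
    by (rule openin_topology_generated_by)
  then have "\<forall>\<uu>\<in>U. \<exists>A\<subseteq>Z. \<uu> \<in> beta_basic Z A \<and> beta_basic Z A \<subseteq> U"
  proof induction
    case (Int U V)
    show ?case
    proof
      fix \<uu> assume "\<uu> \<in> U \<inter> V"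
      then have uv: "\<uu> \<in> U" "\<uu> \<in> V" by simp_all
      from bspec[OF Int.IH(1) uv(1)] obtain A
        where A: "A \<subseteq> Z" "\<uu> \<in> beta_basic Z A" "beta_basic Z A \<subseteq> U"
        by (elim exE conjE)
      from bspec[OF Int.IH(2) uv(2)] obtain B
        where B: "B \<subseteq> Z" "\<uu> \<in> beta_basic Z B" "beta_basic Z B \<subseteq> V"
        by (elim exE conjE)
      show "\<exists>A\<subseteq>Z. \<uu> \<in> beta_basic Z A \<and> beta_basic Z A \<subseteq> U \<inter> V"
        using A B by (intro exI[of _ "A \<inter> B"]) (simp only: beta_basic_Int, blast)
    qed
  next
    case (UN K)
    show ?case
    proof
      fix \<uu> assume "\<uu> \<in> \<Union>K"
      then obtain U where U: "U \<in> K" "\<uu> \<in> U" by (rule UnionE)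
      from bspec[OF UN.IH[OF U(1)] U(2)] obtain A
        where "A \<subseteq> Z" "\<uu> \<in> beta_basic Z A" "beta_basic Z A \<subseteq> U"
        by (elim exE conjE)
      then show "\<exists>A\<subseteq>Z. \<uu> \<in> beta_basic Z A \<and> beta_basic Z A \<subseteq> \<Union>K"
        using Union_upper[OF U(1)] by (intro exI[of _ A]) simp
    qed
  next
    case (Basis U)
    then obtain A where "A \<subseteq> Z" "U = beta_basic Z A"
      by (elim CollectE exE conjE)
    then show ?case by (intro ballI exI[of _ A]) simp
  qed simp
  from bspec[OF this assms(2)] show thesis
    by (elim exE conjE) (rule that)
qed

text \<open>A basic neighbourhood of \<open>\<uu>\<close> comes from a set \<open>A\<close> in
  \<open>\<uu>\<close>. As \<open>\<uu>\<close> is proper, \<open>A\<close> has a point, and its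
  principal ultrafilter lies in that neighbourhood.\<close>

lemma principal_dense:
  "beta_topology Z closure_of ((\<lambda>z. principal {z}) ` Z) = ultrafilters Z"
proof
  show "beta_topology Z closure_of ((\<lambda>z. principal {z}) ` Z) \<subseteq> ultrafilters Z"
    by (metis closure_of_subset_topspace topspace_beta_topology)
  show "ultrafilters Z \<subseteq> beta_topology Z closure_of ((\<lambda>z. principal {z}) ` Z)"
  proof
    fix \<uu> assume u: "\<uu> \<in> ultrafilters Z"
    have "\<exists>y\<in>(\<lambda>z. principal {z}) ` Z. y \<in> T"
      if "openin (beta_topology Z) T" "\<uu> \<in> T" for T
    proof -
      from that obtain A where A: "A \<subseteq> Z" "\<uu> \<in> beta_basic Z A" "beta_basic Z A \<subseteq> T"
        by (rule openin_beta_basic_nbhd)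
      from A(2) ultrafilters_not_bot[OF u] obtain a where a: "a \<in> A"
        unfolding beta_basic_def mem_Collect_eq using eventually_happens by blast
      with A(1) have "a \<in> Z" by (rule subsetD)
      moreover from this a have "principal {a} \<in> beta_basic Z A"
        by (simp add: beta_basic_def eventually_principal principal_in_ultrafilters)
      ultimately show ?thesis
        using A(3) by (intro bexI[of _ "principal {a}"]) (simp_all add: subsetD)
    qed
    then show "\<uu> \<in> beta_topology Z closure_of ((\<lambda>z. principal {z}) ` Z)"
      unfolding in_closure_of topspace_beta_topology using u by simp
  qed
qed

text \<open>Density of the principal ultrafilters, in the form used twice below: for one argument of
  a right continuous map, and for the ultrafilter that interprets a symbol.\<close>

lemma continuous_maps_beta_eq:
  assumes "Hausdorff_space T"
    and "continuous_map (beta_topology Z) T f" and "continuous_map (beta_topology Z) T g"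
    and "\<And>z. z \<in> Z \<Longrightarrow> f (principal {z}) = g (principal {z})"
    and "\<uu> \<in> ultrafilters Z"
  shows "f \<uu> = g \<uu>"
proof (rule forall_in_closure_of_eq[OF _ assms(1-3)])
  show "\<uu> \<in> beta_topology Z closure_of ((\<lambda>z. principal {z}) ` Z)"
    using assms(5) by (simp add: principal_dense)
  show "f x = g x" if "x \<in> (\<lambda>z. principal {z}) ` Z" for x
    using that by (elim imageE) (simp add: assms(4))
qed

lemma Hausdorff_beta_topology: "Hausdorff_space (beta_topology Z)"
  unfolding Hausdorff_space_def topspace_beta_topology
proof (intro allI impI)
  fix \<uu> \<vv> assume H: "\<uu> \<in> ultrafilters Z \<and> \<vv> \<in> ultrafilters Z \<and> \<uu> \<noteq> \<vv>"
  then obtain P where P: "(\<forall>\<^sub>F z in \<uu>. P z) \<noteq> (\<forall>\<^sub>F z in \<vv>. P z)"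
    by (auto simp: filter_eq_iff)
  \<comment> \<open>\<open>Q\<close> is \<open>P\<close> or its negation, whichever holds along
    \<open>\<uu>\<close>; by self-duality the negation of \<open>Q\<close> then holds along
    \<open>\<vv>\<close>, and the two basic sets are disjoint.\<close>
  define Q where "Q = (if \<forall>\<^sub>F z in \<uu>. P z then P else (\<lambda>z. \<not> P z))"
  have Q: "\<forall>\<^sub>F z in \<uu>. Q z" "\<forall>\<^sub>F z in \<vv>. \<not> Q z"
    using H P by (auto simp: Q_def ultrafilters_eventually_not)
  show "\<exists>U V. openin (beta_topology Z) U \<and> openin (beta_topology Z) V \<and>
      \<uu> \<in> U \<and> \<vv> \<in> V \<and> disjnt U V"
    by (rule exI[of _ "{\<uu> \<in> ultrafilters Z. \<forall>\<^sub>F z in \<uu>. Q z}"],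
        rule exI[of _ "{\<uu> \<in> ultrafilters Z. \<forall>\<^sub>F z in \<uu>. \<not> Q z}"])
      (use H Q in \<open>auto simp: openin_beta_basic disjnt_def ultrafilters_eventually_not\<close>)
qed

lemma continuous_map_into_beta:
  assumes "f \<in> topspace T \<rightarrow> ultrafilters Z"
    and "\<And>P. openin T {x \<in> topspace T. \<forall>\<^sub>F z in f x. P z}"
  shows "continuous_map T (beta_topology Z) f"
  unfolding beta_topology_def
proof (rule continuous_on_generated_topo)
  fix U assume "U \<in> {{\<uu> \<in> ultrafilters Z. \<forall>\<^sub>F z in \<uu>. z \<in> A} | A. A \<subseteq> Z}"
  then obtain A where "U = {\<uu> \<in> ultrafilters Z. \<forall>\<^sub>F z in \<uu>. z \<in> A}" by blast
  with assms(1) have "f -` U \<inter> topspace T = {x \<in> topspace T. \<forall>\<^sub>F z in f x. z \<in> A}" by auto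
  with assms(2) show "openin T (f -` U \<inter> topspace T)" by simp
next
  \<comment> \<open>The union of the generators is all of \<open>ultrafilters Z\<close>, so this is
    the range condition on \<open>f\<close>.\<close>
  show "f ` topspace T \<subseteq> \<Union> {{\<uu> \<in> ultrafilters Z. \<forall>\<^sub>F z in \<uu>. z \<in> A} | A. A \<subseteq> Z}"
    using assms(1) topspace_beta_topology[of Z]
    unfolding beta_topology_def topology_generated_by_topspace by auto
qed

lemma continuous_map_into_bool:
  assumes "openin T {x \<in> topspace T. f x}" and "openin T {x \<in> topspace T. \<not> f x}"
  shows "continuous_map T (discrete_topology UNIV) f"
proof -
  have "openin T {x \<in> topspace T. f x \<in> U}" for U :: "bool set"
  proof -
    have "{x \<in> topspace T. f x \<in> U} = (if True \<in> U then {x \<in> topspace T. f x} else {}) \<union>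
        (if False \<in> U then {x \<in> topspace T. \<not> f x} else {})"
      by (rule set_eqI, case_tac "f x") auto
    moreover have "openin T \<dots>"
      using assms by (intro openin_Un) simp_all
    ultimately show ?thesis by simp
  qed
  then show ?thesis by (simp add: continuous_map)
qed

section \<open>Iterated ultrafilter quantifiers\<close>

lemma iter_ev_append:
  "iter_ev (us @ vs) \<phi> \<longleftrightarrow> iter_ev us (\<lambda>xs. iter_ev vs (\<lambda>ys. \<phi> (xs @ ys)))"
  by (induction us arbitrary: \<phi>) simp_all

lemma iter_ev_principal_tuple: "iter_ev (principal_tuple as) \<phi> \<longleftrightarrow> \<phi> as"
  by (induction as arbitrary: \<phi>) (simp_all add: eventually_principal)

lemma iter_ev_not:
  assumes "set us \<subseteq> ultrafilters X"
  shows "iter_ev us (\<lambda>xs. \<not> \<phi> xs) \<longleftrightarrow> \<not> iter_ev us \<phi>"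
  using assms by (induction us arbitrary: \<phi>) (auto simp: ultrafilters_eventually_not)

text \<open>Each ultrafilter is concentrated on \<open>X\<close>, so the coordinates can be placed
  in \<open>X\<close> one at a time.\<close>

lemma iter_ev_nlists:
  assumes "us \<in> nlists n (ultrafilters X)"
  shows "iter_ev us (\<lambda>xs. xs \<in> nlists n X)"
  using assms
proof (induction us arbitrary: n)
  case (Cons u us)
  then obtain m where m: "n = Suc m" "u \<in> ultrafilters X" "us \<in> nlists m (ultrafilters X)"
    by (cases n) auto
  have "iter_ev us (\<lambda>xs. x # xs \<in> nlists n X)" if "x \<in> X" for x
    using Cons.IH[OF m(3)] by (rule iter_ev_mono) (simp add: m(1) that)
  then have "\<forall>\<^sub>F x in u. iter_ev us (\<lambda>xs. x # xs \<in> nlists n X)"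
    by (rule eventually_mono[OF ultrafilters_eventually_carrier[OF m(2)]])
  then show ?case by simp
qed (simp add: nlists_def del: nlistsE_length nlistsE_set)

text \<open>The source of right continuity: principal quantifiers on the left are evaluations, and
  those on the right are absorbed into the predicate. Only the quantifier over \<open>\<uu>\<close>
  remains outermost, which gives a basic set.\<close>

lemma openin_iter_ev_slice:
  "openin (beta_topology X) {\<uu> \<in> ultrafilters X. iter_ev (principal_tuple as @ \<uu> # us) \<phi>}"
  by (simp add: iter_ev_append iter_ev_principal_tuple openin_beta_basic)

section \<open>Right continuous maps\<close>

lemma RC_PiE: "g \<in> RC X n T \<Longrightarrow> g \<in> nlists n (ultrafilters X) \<rightarrow>\<^sub>E topspace T"
  by (simp add: RC_def)

text \<open>At each step the leftmost free argument is compared by density: both maps are continuous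
  in it because everything to its left is principal.\<close>

lemma RC_eqI:
  assumes g: "g \<in> RC X n T" and h: "h \<in> RC X n T" and "Hausdorff_space T"
    and eq: "\<And>a. a \<in> nlists n X \<Longrightarrow> g (principal_tuple a) = h (principal_tuple a)"
  shows "g = h"
proof -
  \<comment> \<open>The induction is on the suffix \<open>us\<close> with the prefix
    \<open>as\<close> arbitrary, since a principal head \<open>x\<close> of the suffix is moved to
    the end of the prefix.\<close>
  have *: "g (principal_tuple as @ us) = h (principal_tuple as @ us)"
    if "set as \<subseteq> X" "set us \<subseteq> ultrafilters X" "length as + length us = n" for as us
    using that
  proof (induction us arbitrary: as)
    case Nil
    then have "as \<in> nlists n X"
      by (auto intro: nlistsI)
    then show ?case using eq by simp
  next
    case (Cons \<uu> us)
    show ?case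
    proof (rule continuous_maps_beta_eq[where Z = X])
      show "continuous_map (beta_topology X) T (\<lambda>\<uu>. g (principal_tuple as @ \<uu> # us))"
        using g Cons.prems by (simp add: RC_def)
      show "continuous_map (beta_topology X) T (\<lambda>\<uu>. h (principal_tuple as @ \<uu> # us))"
        using h Cons.prems by (simp add: RC_def)
      show "g (principal_tuple as @ principal {x} # us) = h (principal_tuple as @ principal {x} # us)"
        if "x \<in> X" for x
        using Cons.IH[of "as @ [x]"] Cons.prems that by simp
    qed (use Cons.prems assms(3) in auto)
  qed
  show ?thesis
  proof
    fix us
    show "g us = h us"
    proof (cases "us \<in> nlists n (ultrafilters X)")
      case True
      then have "set us \<subseteq> ultrafilters X" "length us = n" by simp_all
      then show ?thesis using *[of "[]" us] by simp
    next
      case False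
      \<comment> \<open>Both maps are extensional, so off the domain both take the value
        \<open>undefined\<close>.\<close>
      then show ?thesis
        using PiE_arb[OF RC_PiE[OF g]] PiE_arb[OF RC_PiE[OF h]] by metis
    qed
  qed
qed

lemma topspace_RC_topology: "topspace (RC_topology X n T) = RC X n T"
  unfolding RC_topology_def topology_generated_by_topspace by auto

lemma principal_tuple_in_nlists:
  "a \<in> nlists n X \<Longrightarrow> principal_tuple a \<in> nlists n (ultrafilters X)"
  by (auto simp: nlists_def simp del: nlistsE_length nlistsE_set intro: principal_in_ultrafilters)

text \<open>The subbase of \<open>RC_topology\<close> consists of preimages under these evaluations
  at principal tuples.\<close>

lemma continuous_map_RC_eval:
  assumes "a \<in> nlists n X"
  shows "continuous_map (RC_topology X n T) T (\<lambda>g. g (principal_tuple a))"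
  unfolding continuous_map topspace_RC_topology
proof (intro conjI allI impI)
  show "(\<lambda>g. g (principal_tuple a)) ` RC X n T \<subseteq> topspace T"
    using principal_tuple_in_nlists[OF assms] by (auto dest!: RC_PiE)
  show "openin (RC_topology X n T) {g \<in> RC X n T. g (principal_tuple a) \<in> U}"
    if "openin T U" for U
    unfolding RC_topology_def using assms that by (intro topology_generated_by_Basis) blast
qed

text \<open>The universal property of the initial topology for evaluations at principal
  tuples.\<close>

lemma continuous_map_into_RC:
  assumes "h \<in> topspace Y \<rightarrow> RC X n T"
    and "\<And>a. a \<in> nlists n X \<Longrightarrow> continuous_map Y T (\<lambda>y. h y (principal_tuple a))"
  shows "continuous_map Y (RC_topology X n T) h"
  unfolding RC_topology_def
proof (rule continuous_on_generated_topo)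
  fix U
  assume "U \<in> insert (RC X n T)
    {{g \<in> RC X n T. g (principal_tuple a) \<in> V} | a V. a \<in> nlists n X \<and> openin T V}"
  then show "openin Y (h -` U \<inter> topspace Y)"
  proof (elim insertE CollectE exE conjE)
    assume "U = RC X n T"
    then have "h -` U \<inter> topspace Y = topspace Y"
      using assms(1) by (auto simp: Pi_iff)
    then show ?thesis by simp
  next
    fix a V
    assume U: "U = {g \<in> RC X n T. g (principal_tuple a) \<in> V}"
      and "a \<in> nlists n X" "openin T V"
    then have "openin Y {y \<in> topspace Y. h y (principal_tuple a) \<in> V}"
      using assms(2) by (intro openin_continuous_map_preimage)
    moreover have "h -` U \<inter> topspace Y = {y \<in> topspace Y. h y (principal_tuple a) \<in> V}"
      using assms(1) unfolding U by (auto simp: Pi_iff)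
    ultimately show ?thesis by simp
  qed
qed (use assms(1) in auto)

text \<open>Discharges the definite description. For a rival \<open>k\<close>, composing
  \<open>k\<close> and \<open>h\<close> with evaluation at a principal tuple gives continuous maps
  into \<open>T\<close> that agree on principal ultrafilters, hence everywhere;
  \<open>RC_eqI\<close> then lifts this to equality in \<open>RC\<close>.\<close>

lemma continuous_ext_RC_eqI:
  assumes "Hausdorff_space T"
    and h: "h \<in> extensional (ultrafilters Z)" "continuous_map (beta_topology Z) (RC_topology X n T) h"
      "\<And>z. z \<in> Z \<Longrightarrow> h (principal {z}) = j z"
  shows "continuous_ext Z (RC_topology X n T) j = h"
  unfolding continuous_ext_def
proof (rule the_equality)
  fix k
  assume k: "k \<in> extensional (ultrafilters Z) \<and>
    continuous_map (beta_topology Z) (RC_topology X n T) k \<and> (\<forall>z\<in>Z. k (principal {z}) = j z)"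
  show "k = h"
  proof (rule extensionalityI)
    fix \<uu> assume u: "\<uu> \<in> ultrafilters Z"
    have mem: "k \<uu> \<in> RC X n T" "h \<uu> \<in> RC X n T"
      using k h(2) u by (auto dest!: continuous_map_funspace
          simp: topspace_RC_topology topspace_beta_topology Pi_iff)
    show "k \<uu> = h \<uu>"
    proof (rule RC_eqI[OF mem assms(1)])
      fix a assume "a \<in> nlists n X"
      note eval = continuous_map_RC_eval[OF this, of T]
      show "k \<uu> (principal_tuple a) = h \<uu> (principal_tuple a)"
        by (rule continuous_maps_beta_eq[OF assms(1), where Z = Z])
          (use k h u continuous_map_compose[OF _ eval] in \<open>auto simp: comp_def\<close>)
    qed
  qed (use k h in auto)
qed (use h in auto)

section \<open>The interpretation of symbols in the two models\<close>

text \<open>Almost all tuples lie in \<open>nlists n X\<close> and almost all \<open>f\<close> map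
  them into \<open>X\<close>. Negation passes through the quantifier over \<open>f\<close> and then
  through the iterated ones.\<close>

lemma app_tilde_in_ultrafilters:
  assumes us: "us \<in> nlists n (ultrafilters X)"
    and f: "\<ff> \<in> ultrafilters (nlists n X \<rightarrow>\<^sub>E X)"
  shows "app_tilde us \<ff> \<in> ultrafilters X"
proof (rule ultrafiltersI)
  show "\<forall>\<^sub>F x in app_tilde us \<ff>. x \<in> X"
    unfolding eventually_app_tilde using iter_ev_nlists[OF us]
  proof (rule iter_ev_mono)
    fix xs assume "xs \<in> nlists n X"
    then show "\<forall>\<^sub>F f in \<ff>. f xs \<in> X"
      by (auto intro: eventually_mono[OF ultrafilters_eventually_carrier[OF f]])
  qed
  show "(\<forall>\<^sub>F x in app_tilde us \<ff>. \<not> P x) \<longleftrightarrow> \<not> (\<forall>\<^sub>F x in app_tilde us \<ff>. P x)" for P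
    using us by (simp add: eventually_app_tilde ultrafilters_eventually_not[OF f]
        iter_ev_not[where X = X])
qed

lemma slice_in_nlists:
  assumes "set as \<subseteq> X" "set us \<subseteq> ultrafilters X" "length as + 1 + length us = n"
    and "\<uu> \<in> ultrafilters X"
  shows "principal_tuple as @ \<uu> # us \<in> nlists n (ultrafilters X)"
  using assms by (auto simp: nlists_def simp del: nlistsE_length nlistsE_set intro: principal_in_ultrafilters)

lemma app_tilde_in_RC:
  assumes f: "\<ff> \<in> ultrafilters (nlists n X \<rightarrow>\<^sub>E X)"
  shows "(\<lambda>us\<in>nlists n (ultrafilters X). app_tilde us \<ff>) \<in> RC X n (beta_topology X)"
  unfolding RC_def
proof (intro CollectI conjI allI impI)
  show "(\<lambda>us\<in>nlists n (ultrafilters X). app_tilde us \<ff>)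
      \<in> nlists n (ultrafilters X) \<rightarrow>\<^sub>E topspace (beta_topology X)"
    by (simp add: restrict_PiE_iff topspace_beta_topology app_tilde_in_ultrafilters[OF _ f])
  fix as us
  assume "set as \<subseteq> X \<and> set us \<subseteq> ultrafilters X \<and> length as + 1 + length us = n"
  then have slice: "principal_tuple as @ \<uu> # us \<in> nlists n (ultrafilters X)"
    if "\<uu> \<in> ultrafilters X" for \<uu>
    using slice_in_nlists[of as X us n \<uu>] that by simp
  have "continuous_map (beta_topology X) (beta_topology X)
      (\<lambda>\<uu>. app_tilde (principal_tuple as @ \<uu> # us) \<ff>)"
    using app_tilde_in_ultrafilters[OF slice f]
    by (intro continuous_map_into_beta)
      (auto simp: topspace_beta_topology eventually_app_tilde openin_iter_ev_slice)
  then show "continuous_map (beta_topology X) (beta_topology X)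
      (\<lambda>\<uu>. (\<lambda>us\<in>nlists n (ultrafilters X). app_tilde us \<ff>) (principal_tuple as @ \<uu> # us))"
    \<comment> \<open>The slice stays inside the domain of the restricted map, so the restriction
      does not alter it.\<close>
    by (rule continuous_map_eq) (simp add: topspace_beta_topology slice)
qed

text \<open>At a principal tuple \<open>a\<close> only the quantifier over \<open>f\<close>
  survives, so the dependence on \<open>\<ff>\<close> is continuous. At a principal
  \<open>\<ff>\<close> that quantifier collapses instead and leaves \<open>fun_ext\<close>.
  Uniqueness of the extension does the rest.\<close>

lemma e_fun_eq:
  "e_fun X n = (\<lambda>\<ff>\<in>ultrafilters (nlists n X \<rightarrow>\<^sub>E X). \<lambda>us\<in>nlists n (ultrafilters X). app_tilde us \<ff>)"
    (is "_ = ?h")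
  unfolding e_fun_def
proof (rule continuous_ext_RC_eqI[OF Hausdorff_beta_topology])
  let ?Z = "nlists n X \<rightarrow>\<^sub>E X"
  show "continuous_map (beta_topology ?Z) (RC_topology X n (beta_topology X)) ?h"
  proof (rule continuous_map_into_RC)
    fix a assume a: "a \<in> nlists n X"
    have "continuous_map (beta_topology ?Z) (beta_topology X)
        (\<lambda>\<ff>. app_tilde (principal_tuple a) \<ff>)"
      using app_tilde_in_ultrafilters[OF principal_tuple_in_nlists[OF a]]
      by (intro continuous_map_into_beta)
        (auto simp: topspace_beta_topology eventually_app_tilde iter_ev_principal_tuple
          openin_beta_basic)
    then show "continuous_map (beta_topology ?Z) (beta_topology X)
        (\<lambda>\<ff>. ?h \<ff> (principal_tuple a))"
      by (rule continuous_map_eq)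
        (simp add: topspace_beta_topology principal_tuple_in_nlists[OF a])
  qed (auto simp: topspace_beta_topology intro!: app_tilde_in_RC)
  show "?h (principal {f}) = fun_ext X n f" if "f \<in> ?Z" for f
    using principal_in_ultrafilters[OF that]
    by (simp add: fun_ext_def app_tilde_def eventually_principal)
qed simp

lemma in_tilde_not:
  assumes "us \<in> nlists n (ultrafilters X)" "\<rr> \<in> ultrafilters Z"
  shows "\<not> in_tilde us \<rr> \<longleftrightarrow> iter_ev us (\<lambda>xs. \<forall>\<^sub>F Q in \<rr>. xs \<notin> Q)"
  using assms by (simp add: in_tilde_def ultrafilters_eventually_not iter_ev_not[where X = X])

text \<open>With a discrete two-point codomain both fibres of a slice must be open. The negative one
  has the same quantifier form once negation is pushed inward by
  \<open>in_tilde_not\<close>.\<close>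

lemma in_tilde_in_RC:
  assumes r: "\<rr> \<in> ultrafilters Z"
  shows "(\<lambda>us\<in>nlists n (ultrafilters X). in_tilde us \<rr>) \<in> RC X n (discrete_topology UNIV)"
  unfolding RC_def
proof (intro CollectI conjI allI impI)
  fix as us
  assume "set as \<subseteq> X \<and> set us \<subseteq> ultrafilters X \<and> length as + 1 + length us = n"
  then have slice: "principal_tuple as @ \<uu> # us \<in> nlists n (ultrafilters X)"
    if "\<uu> \<in> ultrafilters X" for \<uu>
    using slice_in_nlists[of as X us n \<uu>] that by simp
  have "continuous_map (beta_topology X) (discrete_topology UNIV)
      (\<lambda>\<uu>. in_tilde (principal_tuple as @ \<uu> # us) \<rr>)"
  proof (rule continuous_map_into_bool)
    show "openin (beta_topology X)
        {\<uu> \<in> topspace (beta_topology X). in_tilde (principal_tuple as @ \<uu> # us) \<rr>}"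
      by (simp add: topspace_beta_topology in_tilde_def openin_iter_ev_slice)
    have "{\<uu> \<in> topspace (beta_topology X). \<not> in_tilde (principal_tuple as @ \<uu> # us) \<rr>} =
        {\<uu> \<in> ultrafilters X.
          iter_ev (principal_tuple as @ \<uu> # us) (\<lambda>xs. \<forall>\<^sub>F Q in \<rr>. xs \<notin> Q)}"
      using in_tilde_not[OF slice r] by (auto simp: topspace_beta_topology)
    then show "openin (beta_topology X)
        {\<uu> \<in> topspace (beta_topology X). \<not> in_tilde (principal_tuple as @ \<uu> # us) \<rr>}"
      by (simp only: openin_iter_ev_slice)
  qed
  then show "continuous_map (beta_topology X) (discrete_topology UNIV)
      (\<lambda>\<uu>. (\<lambda>us\<in>nlists n (ultrafilters X). in_tilde us \<rr>) (principal_tuple as @ \<uu> # us))"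
    by (rule continuous_map_eq) (simp add: topspace_beta_topology slice)
qed simp

text \<open>As for operations: principal tuples leave a single quantifier over \<open>Q\<close>,
  whose two fibres are basic sets, and a principal \<open>\<rr>\<close> reduces
  \<open>in_tilde\<close> to membership in \<open>rel_ext\<close>.\<close>

lemma e_char_eq:
  "e_char X n = (\<lambda>\<rr>\<in>ultrafilters (Pow (nlists n X)). \<lambda>us\<in>nlists n (ultrafilters X). in_tilde us \<rr>)"
    (is "_ = ?h")
  unfolding e_char_def
proof (rule continuous_ext_RC_eqI)
  let ?Z = "Pow (nlists n X)"
  show "continuous_map (beta_topology ?Z) (RC_topology X n (discrete_topology UNIV)) ?h"
  proof (rule continuous_map_into_RC)
    fix a assume a: "a \<in> nlists n X"
    have "continuous_map (beta_topology ?Z) (discrete_topology UNIV)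
        (\<lambda>\<rr>. in_tilde (principal_tuple a) \<rr>)"
    proof (rule continuous_map_into_bool)
      have "{\<rr> \<in> topspace (beta_topology ?Z). \<not> in_tilde (principal_tuple a) \<rr>} =
          {\<rr> \<in> ultrafilters ?Z. \<forall>\<^sub>F Q in \<rr>. a \<notin> Q}"
        by (auto simp: topspace_beta_topology in_tilde_def iter_ev_principal_tuple
            ultrafilters_eventually_not)
      then show "openin (beta_topology ?Z)
          {\<rr> \<in> topspace (beta_topology ?Z). \<not> in_tilde (principal_tuple a) \<rr>}"
        by (simp only: openin_beta_basic)
    qed (simp add: topspace_beta_topology in_tilde_def iter_ev_principal_tuple openin_beta_basic)
    then show "continuous_map (beta_topology ?Z) (discrete_topology UNIV)
        (\<lambda>\<rr>. ?h \<rr> (principal_tuple a))"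
      by (rule continuous_map_eq)
        (simp add: topspace_beta_topology principal_tuple_in_nlists[OF a])
  qed (auto simp: topspace_beta_topology intro!: in_tilde_in_RC)
  show "?h (principal {Q}) = (\<lambda>us\<in>nlists n (ultrafilters X). us \<in> rel_ext X n Q)" if "Q \<in> ?Z" for Q
    using principal_in_ultrafilters[OF that]
    by (auto simp: rel_ext_def in_tilde_def eventually_principal fun_eq_iff)
qed simp_all

lemma e_rel_eq:
  assumes "\<rr> \<in> ultrafilters (Pow (nlists n X))"
  shows "e_rel X n \<rr> = {us \<in> nlists n (ultrafilters X). in_tilde us \<rr>}"
  using assms by (auto simp: e_rel_def e_char_eq)

section \<open>Terms and formulas\<close>

lemma e_model_simps [simp]:
  "univ (e_model S A) = ultrafilters (base A)"
  "fun_int (e_model S A) F = e_fun (base A) (fun_arity S F) (gfun_int A F)"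
  "pred_int (e_model S A) R = e_rel (base A) (pred_arity S R) (gpred_int A R)"
  by (simp_all add: e_model_def)

text \<open>The two claims are proved together: \<open>e_fun\<close> agrees with
  \<open>app_tilde\<close> only on tuples of ultrafilters, so the arguments must be known to be such
  before the values can be compared.\<close>

lemma gval_e_model:
  assumes "is_gen_model S A" and "wf_tm S t"
    and "\<And>x. x \<in> vars_tm t \<Longrightarrow> v x \<in> ultrafilters (base A)"
  shows "gval A v t \<in> ultrafilters (base A) \<and> val (e_model S A) v t = gval A v t"
  using assms(2,3)
proof (induction t)
  case (Fun F ts)
  let ?X = "base A" and ?n = "fun_arity S F"
  have F: "gfun_int A F \<in> ultrafilters (nlists ?n ?X \<rightarrow>\<^sub>E ?X)"
    using assms(1) Fun.prems(1) by (simp add: is_gen_model_def)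
  have IH: "gval A v t \<in> ultrafilters ?X \<and> val (e_model S A) v t = gval A v t"
    if "t \<in> set ts" for t
    using Fun that by (auto simp: list_all_iff)
  then have map_eq: "map (val (e_model S A) v) ts = map (gval A v) ts"
    by simp
  have "map (gval A v) ts \<in> nlists ?n (ultrafilters ?X)"
    using Fun.prems(1) by (intro nlistsI) (simp, use IH in fastforce)
  then show ?case
    using F app_tilde_in_ultrafilters[OF _ F] by (simp add: map_eq e_fun_eq)
qed simp

theorem theorem23:
  fixes S :: "('f, 'p) signature"
    and A :: "('a, 'f, 'p) gen_model"
    and \<phi> :: "('f, 'p) fm"
    and v :: "nat \<Rightarrow> 'a filter"
  assumes "is_gen_model S A"
    and "wf_fm S \<phi>"
    and "\<And>x. x \<in> free_vars \<phi> \<Longrightarrow> v x \<in> ultrafilters (base A)"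
  shows "gsat A \<phi> v \<longleftrightarrow> sat (e_model S A) \<phi> v"
  using assms(2,3)
\<comment> \<open>The valuation is generalised because the quantifier cases need the hypothesis at
  \<open>v(x := \<uu>)\<close>.\<close>
proof (induction \<phi> arbitrary: v)
  case (Eq s t)
  then show ?case using gval_e_model[OF assms(1)] by simp
next
  case (Rel R ts)
  let ?X = "base A" and ?n = "pred_arity S R"
  have R: "gpred_int A R \<in> ultrafilters (Pow (nlists ?n ?X))"
    using assms(1) Rel.prems(1) by (simp add: is_gen_model_def)
  have IH: "gval A v t \<in> ultrafilters ?X \<and> val (e_model S A) v t = gval A v t"
    if "t \<in> set ts" for t
    by (rule gval_e_model[OF assms(1)]) (use Rel that in \<open>auto simp: list_all_iff\<close>)
  then have map_eq: "map (val (e_model S A) v) ts = map (gval A v) ts"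
    by simp
  \<comment> \<open>This places the argument tuple where \<open>e_rel_eq\<close> turns membership in
    \<open>e_rel\<close> into \<open>in_tilde\<close>.\<close>
  have "map (gval A v) ts \<in> nlists ?n (ultrafilters ?X)"
    using Rel.prems(1) by (intro nlistsI) (simp, use IH in fastforce)
  then show ?case
    using R by (simp add: map_eq e_rel_eq)
next
  case (Neg \<phi>)
  have "gsat A \<phi> v \<longleftrightarrow> sat (e_model S A) \<phi> v"
    by (rule Neg.IH) (use Neg.prems in simp_all)
  then show ?case by simp
next
  case (Conj \<phi> \<psi>)
  have "gsat A \<phi> v \<longleftrightarrow> sat (e_model S A) \<phi> v"
    by (rule Conj.IH(1)) (use Conj.prems in simp_all)
  moreover have "gsat A \<psi> v \<longleftrightarrow> sat (e_model S A) \<psi> v"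
    by (rule Conj.IH(2)) (use Conj.prems in simp_all)
  ultimately show ?case by simp
next
  case (Forall x \<phi>)
  \<comment> \<open>The bound variable receives the ultrafilter \<open>\<uu>\<close>, and any other
    free variable of the body is free in the quantified formula, so the updated valuation is
    admissible. Both models quantify over the same universe.\<close>
  have "gsat A \<phi> (v(x := \<uu>)) \<longleftrightarrow> sat (e_model S A) \<phi> (v(x := \<uu>))"
    if "\<uu> \<in> ultrafilters (base A)" for \<uu>
    by (rule Forall.IH) (use Forall.prems that in \<open>simp_all split: if_splits\<close>)
  then show ?case by simp
next
  case (Exists x \<phi>)
  have "gsat A \<phi> (v(x := \<uu>)) \<longleftrightarrow> sat (e_model S A) \<phi> (v(x := \<uu>))"
    if "\<uu> \<in> ultrafilters (base A)" for \<uu>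
    by (rule Exists.IH) (use Exists.prems that in \<open>simp_all split: if_splits\<close>)
  then show ?case by simp
qed

end
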